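(* The inequality $$R\sqrt{\frac{\epsilon}{8\mu}}\,\left\|e^{\mu|j+Rt(1-t)e_1|^2-(1+\epsilon)R^2t(1-t)/(16\mu)}g\right\|_{L^2([0,1],\ell^2(\mathbb{Z}^d))}\le\left\|e^{\mu|j+Rt(1-t)e_1|^2-(1+\epsilon)R^2t(1-t)/(16\mu)}(\partial_t-i\Delta_d)g\right\|_{L^2([0,1],\ell^2(\mathbb{Z}^d))}$$ holds, for $R$ large enough, when $\epsilon>0$, $\mu>0$ and $g\in C_0^\infty(\mathbb{Z}^d\times[0,1])$.
   Context: $e_1,\dots,e_d$ is the standard basis of $\mathbb{Z}^d$, $|\cdot|$ is the Euclidean norm on $\mathbb{R}^d$, and $\Delta_d g_j=\sum_{k=1}^d(g_{j+e_k}-2g_j+g_{j-e_k})$. $C_0^\infty(\mathbb{Z}^d\times[0,1])$ denotes the smooth compactly supported functions $g=(g_j(t))$ on $\mathbb{Z}^d\times[0,1]$, that is, $g_j\equiv0$ for all but finitely many $j\in\mathbb{Z}^d$ and each $g_j$ is smooth in $t\in[0,1]$. For a family $h=(h_j(t))_{j\in\mathbb{Z}^d}$, $\|h\|_{L^2([0,1],\ell^2(\mathbb{Z}^d))}^2=\int_0^1\sum_{j\in\mathbb{Z}^d}|h_j(t)|^2\,dt$.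
   Formalization: The functions g are additionally required to vanish at the time endpoints, g_j(0) = g_j(1) = 0 for all j; without this the inequality fails, e.g. for d = 1, μ = 1/4, ε = 1, g_0(t) = e^{-2it}, g_j = 0 otherwise. *)

theory Defs
  imports "HOL-Analysis.Analysis"
begin

text \<open>
  A family \<open>(g_j(t))\<close> indexed by the lattice points \<open>j\<close> is rendered as a function of type
  \<^typ>\<open>int ^ 'd \<Rightarrow> real \<Rightarrow> complex\<close>, so that \<open>d = CARD('d)\<close>. As a finite index type has no
  canonical first element, the direction \<open>e_1\<close> is \<open>axis k1 1\<close> for an arbitrary coordinate \<open>k1\<close>.
\<close>

definition lattice_point :: "int ^ 'd::finite \<Rightarrow> real ^ 'd" where
  "lattice_point j = (\<chi> k. of_int (j $ k))"

definition discrete_laplacian :: "(int ^ 'd::finite \<Rightarrow> complex) \<Rightarrow> int ^ 'd \<Rightarrow> complex" where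
  "discrete_laplacian u j = (\<Sum>k\<in>UNIV. u (j + axis k 1) - 2 * u j + u (j - axis k 1))"

text \<open>Smoothness on the closed interval; at the endpoints the derivatives are one-sided.\<close>

definition smooth_on_unit_interval :: "(real \<Rightarrow> complex) \<Rightarrow> bool" where
  "smooth_on_unit_interval f \<longleftrightarrow>
     (\<exists>D :: nat \<Rightarrow> real \<Rightarrow> complex. D 0 = f \<and>
       (\<forall>n. \<forall>t\<in>{0..1}. (D n has_vector_derivative D (Suc n) t) (at t within {0..1})))"

text \<open>
  The subscript \<open>0\<close> includes vanishing at the time endpoints. This is what makes the boundary
  terms of the integration by parts in \<open>t\<close> disappear, and the Carleman inequality fails
  without it: for \<open>d = 1\<close>, \<open>\<mu> = 1/4\<close>, \<open>\<epsilon> = 1\<close> and \<open>g_j(t) = exp(-2it)\<close> if \<open>j = 0\<close> and \<open>0\<close>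
  otherwise, it is violated for all large \<open>R\<close>. Vanishing at the two endpoints is weaker than
  having support in the open interval.
\<close>

definition C0_infinity :: "(int ^ 'd::finite \<Rightarrow> real \<Rightarrow> complex) set" where
  "C0_infinity = {g. finite {j. \<exists>t\<in>{0..1}. g j t \<noteq> 0} \<and>
                     (\<forall>j. smooth_on_unit_interval (g j)) \<and>
                     (\<forall>j. g j 0 = 0 \<and> g j 1 = 0)}"

definition L2_l2_norm :: "(int ^ 'd::finite \<Rightarrow> real \<Rightarrow> complex) \<Rightarrow> real" where
  "L2_l2_norm h = sqrt (LINT t:{0..1}|lborel. (\<Sum>\<^sub>\<infinity>j. (norm (h j t))\<^sup>2))"

definition schroedinger_op ::
  "(int ^ 'd::finite \<Rightarrow> real \<Rightarrow> complex) \<Rightarrow> int ^ 'd \<Rightarrow> real \<Rightarrow> complex" where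
  "schroedinger_op g j t =
     vector_derivative (g j) (at t within {0..1}) - \<i> * discrete_laplacian (\<lambda>l. g l t) j"

definition carleman_weight ::
  "'d::finite \<Rightarrow> real \<Rightarrow> real \<Rightarrow> real \<Rightarrow> int ^ 'd \<Rightarrow> real \<Rightarrow> real" where
  "carleman_weight k1 \<mu> \<epsilon> R j t =
     exp (\<mu> * (norm (lattice_point j + (R * t * (1 - t)) *\<^sub>R axis k1 1))\<^sup>2
          - (1 + \<epsilon>) * R\<^sup>2 * t * (1 - t) / (16 * \<mu>))"

end

(* Let psi be the exponent of the weight, f = exp(psi) g and F = exp(psi) (d/dt - i Delta) g. Then
   f' = F + S f + i K f, where K is the self-adjoint part of the conjugated Laplacian, A its
   anti-self-adjoint part and S = psi' + i A; both S and i K act on finitely supported families.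
   The energy H = <S f, f> vanishes at t = 0 and t = 1, and
     H' = <(S' + i [S, K]) f, f> + 2 Re <F, S f> + 2 |S f|^2 >= <(S' + i [S, K]) f, f> - |F|^2 / 2.
   The commutator produces 4 sinh(2 mu) sinh^2(2 mu y) |f|^2, with y the first coordinate of
   j + R t (1 - t) e_1. Because sinh(2 mu) > 2 mu, this together with the
   terms 2 mu R^2 (1 - 2 t)^2 and R^2 / (8 mu) of psi'' absorbs, for large R, both the first-order
   cross terms and -4 R mu y. What remains is epsilon R^2 / (8 mu) |f|^2. *)
theory Submission
  imports Defs
begin

subsection \<open>Scalar inequalities\<close>

text \<open>The exponential outgrows every quadratic beyond some threshold \<open>X\<close>; the
  constant \<open>M\<close> covers the bounded range below it.\<close>

lemma cosh_absorbs_square: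
  fixes a b c :: real
  assumes "a > 0" "b > 0"
  shows "\<exists>M. \<forall>y\<ge>0. c * y\<^sup>2 \<le> a * cosh (b * y) + M"
proof -
  have "((\<lambda>x. x\<^sup>2 / exp x) \<longlongrightarrow> (0::real)) at_top"
    by (rule tendsto_power_div_exp_0)
  \<comment> \<open>With x = b y this threshold yields (|c| + 1) y^2 <= a exp(b y) / 2; the factor 2
    pays for exp <= 2 cosh, and the summand 1 keeps the denominator positive.\<close>
  moreover have "a * b\<^sup>2 / (2 * (\<bar>c\<bar> + 1)) > 0" using assms by simp
  ultimately have "\<forall>\<^sub>F x in at_top. x\<^sup>2 / exp x < a * b\<^sup>2 / (2 * (\<bar>c\<bar> + 1))"
    by (rule order_tendstoD)
  then obtain X where X: "\<And>x. x \<ge> X \<Longrightarrow> x\<^sup>2 / exp x < a * b\<^sup>2 / (2 * (\<bar>c\<bar> + 1))"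
    by (auto simp: eventually_at_top_linorder)
  have "c * y\<^sup>2 \<le> a * cosh (b * y) + \<bar>c\<bar> * (X / b)\<^sup>2" if "y \<ge> 0" for y
  proof (cases "b * y \<ge> X")
    case True
    have "(b * y)\<^sup>2 * (2 * (\<bar>c\<bar> + 1)) \<le> a * b\<^sup>2 * exp (b * y)"
      using X[OF True] by (simp add: field_simps)
    then have "b\<^sup>2 * (y\<^sup>2 * (2 * (\<bar>c\<bar> + 1))) \<le> b\<^sup>2 * (a * exp (b * y))"
      by (simp add: power_mult_distrib algebra_simps)
    then have "y\<^sup>2 * (2 * (\<bar>c\<bar> + 1)) \<le> a * exp (b * y)"
      using assms by simp
    moreover have "exp (b * y) \<le> 2 * cosh (b * y)"
      by (simp add: cosh_field_def)
    then have "a * exp (b * y) \<le> a * (2 * cosh (b * y))"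
      using assms by (intro mult_left_mono) auto
    moreover have "c * y\<^sup>2 \<le> (\<bar>c\<bar> + 1) * y\<^sup>2" by (intro mult_right_mono) auto
    ultimately have "c * y\<^sup>2 \<le> a * cosh (b * y)" by (simp add: algebra_simps)
    then show ?thesis by (simp add: add_increasing2)
  next
    case False
    then have "y \<le> X / b" using assms by (simp add: field_simps)
    then have "y\<^sup>2 \<le> (X / b)\<^sup>2" using that by (intro power_mono) auto
    then have "\<bar>c\<bar> * y\<^sup>2 \<le> \<bar>c\<bar> * (X / b)\<^sup>2" by (intro mult_left_mono) auto
    moreover have "c * y\<^sup>2 \<le> \<bar>c\<bar> * y\<^sup>2" by (intro mult_right_mono) auto
    moreover have "a * cosh (b * y) \<ge> 0" using assms by simp
    ultimately show ?thesis by linarith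
  qed
  then show ?thesis by blast
qed

text \<open>The difference \<open>sinh x - x\<close> increases because its derivative
  \<open>cosh x - 1\<close> is positive. The strict gap at 2 mu is what lets the commutator dominate
  the cross terms far from the origin.\<close>

lemma sinh_gt_self: "x < sinh x" if "x > 0" for x :: real
proof -
  have "(\<lambda>x. sinh x - x) 0 < (\<lambda>x. sinh x - x) x"
  proof (rule DERIV_pos_imp_increasing_open[OF that])
    fix y :: real assume "0 < y"
    then have "cosh y > 1" using cosh_real_strict_mono[of 0 y] by simp
    then show "\<exists>d. ((\<lambda>x. sinh x - x) has_real_derivative d) (at y) \<and> 0 < d"
      by (intro exI[of _ "cosh y - 1"]) (auto intro!: derivative_eq_intros)
  qed (auto intro!: continuous_intros)
  then show ?thesis by simp
qed

text \<open>
  Share of the cross term on the edge with midpoint \<open>m\<close> that is charged to the left endpoint (the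
  right endpoint is charged \<open>cost \<mu> R p (- m)\<close>). The endpoint closer to the origin pays with
  \<open>p\<^sup>2\<close>, where \<open>p = R (1 - 2 t)\<close>, and the outer one with \<open>cosh\<^sup>2\<close>: an even split would exceed the
  available \<open>sinh\<^sup>2\<close> when \<open>\<mu>\<close> is large. Near the origin the cost is only linear in \<open>R\<close>.
\<close>

definition cost :: "real \<Rightarrow> real \<Rightarrow> real \<Rightarrow> real \<Rightarrow> real" where
  "cost \<mu> R p m = (if m > 1 then 2 * \<mu> * p\<^sup>2
    else if m < -1 then 8 * \<mu> * (cosh (2 * \<mu> * m))\<^sup>2 else 4 * \<mu> * R * cosh (2 * \<mu>))"

lemma cross_term_cost:
  fixes u v :: real
  assumes "\<mu> > 0" "\<bar>p\<bar> \<le> R" "u \<ge> 0" "v \<ge> 0"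
  shows "8 * \<mu> * \<bar>p\<bar> * cosh (2 * \<mu> * m) * (u * v) \<le> cost \<mu> R p m * u\<^sup>2 + cost \<mu> R p (- m) * v\<^sup>2"
proof -
  define c where "c = cosh (2 * \<mu> * m)"
  have c: "c > 0" by (simp add: c_def)
  \<comment> \<open>The square is weighted so that the \<open>p\<close> share is exactly 2 mu p^2,
    the amount available in the second time derivative of the exponent. The other share has
    coefficient 8 mu, below the 4 sinh(2 mu) of the commutator.\<close>
  have amgm: "8 * \<mu> * \<bar>p\<bar> * c * (a * b) \<le> 2 * \<mu> * p\<^sup>2 * a\<^sup>2 + 8 * \<mu> * c\<^sup>2 * b\<^sup>2" for a b :: real
  proof -
    have "0 \<le> 2 * \<mu> * (\<bar>p\<bar> * a - 2 * c * b)\<^sup>2" using assms by simp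
    also have "\<dots> = 2 * \<mu> * (\<bar>p\<bar>\<^sup>2 * a\<^sup>2) + 8 * \<mu> * c\<^sup>2 * b\<^sup>2 - 8 * \<mu> * \<bar>p\<bar> * c * (a * b)"
      by (simp add: power2_eq_square algebra_simps)
    finally show ?thesis by simp
  qed
  consider "m > 1" | "m < -1" | "\<bar>m\<bar> \<le> 1" by linarith
  then show ?thesis
  proof cases
    case 1
    then show ?thesis using amgm[of u v] by (simp add: cost_def c_def)
  next
    case 2
    then show ?thesis using amgm[of v u] by (simp add: cost_def c_def mult.commute)
  next
    case 3
    have "c = cosh (2 * \<mu> * \<bar>m\<bar>)" by (simp add: c_def abs_if)
    also have "\<dots> \<le> cosh (2 * \<mu>)"
      using 3 assms by (subst cosh_real_nonneg_le_iff) auto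
    finally have "c \<le> cosh (2 * \<mu>)" .
    then have "\<bar>p\<bar> * c \<le> R * cosh (2 * \<mu>)" using assms c by (intro mult_mono) auto
    then have "4 * \<mu> * (\<bar>p\<bar> * c) * (2 * u * v) \<le> 4 * \<mu> * (R * cosh (2 * \<mu>)) * (2 * u * v)"
      using assms by (intro mult_right_mono mult_left_mono) auto
    also have "\<dots> \<le> 4 * \<mu> * (R * cosh (2 * \<mu>)) * (u\<^sup>2 + v\<^sup>2)"
      using assms by (intro mult_left_mono sum_squares_bound) auto
    finally have 1: "4 * \<mu> * (\<bar>p\<bar> * c) * (2 * u * v) \<le> 4 * \<mu> * (R * cosh (2 * \<mu>)) * (u\<^sup>2 + v\<^sup>2)" .
    show ?thesis proof -
      have "\<not> m > 1" "\<not> m < -1" using 3 by linarith+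
      then have "cost \<mu> R p m = 4 * \<mu> * R * cosh (2 * \<mu>)" "cost \<mu> R p (- m) = 4 * \<mu> * R * cosh (2 * \<mu>)"
        by (simp_all add: cost_def)
      then show ?thesis using 1 unfolding c_def by (simp add: algebra_simps)
    qed
  qed
qed

text \<open>A point with coordinate y is the left end of the edge with midpoint y + 1/2 and the
  right end of the edge with midpoint y - 1/2, so it is charged both costs. For |y| > 3/2 one of
  them is 2 mu p^2, and the other grows at most like 4 mu cosh(4 mu |y|), where 4 mu < 2 sinh(2 mu).
  For |y| <= 3/2 the excess over 2 mu p^2 is linear in R and loses to R^2 / (8 mu).\<close>

lemma total_cost:
  assumes "\<mu> > 0"
  shows "\<exists>R0\<ge>0. \<forall>R\<ge>R0. \<forall>p y. cost \<mu> R p (y + 1/2) + cost \<mu> R p (1/2 - y) \<le>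
    4 * sinh (2 * \<mu>) * (sinh (2 * \<mu> * y))\<^sup>2 + 2 * \<mu> * p\<^sup>2 - 4 * R * \<mu> * y + R\<^sup>2 / (8 * \<mu>)"
proof -
  define s where "s = sinh (2 * \<mu>)"
  define K where "K = cosh (2 * \<mu>)"
  have s: "s > 2 * \<mu>" unfolding s_def using assms by (intro sinh_gt_self) auto
  \<comment> \<open>2 s - 4 mu is the surplus of the commutator over the \<open>cosh\<close> cost,
    both written with cosh(4 mu y). The coefficient 256 mu^3 is 64 mu^2 times 4 mu, from the case R
    < 64 mu^2 y below.\<close>
  obtain M where M: "\<And>y. y \<ge> 0 \<Longrightarrow> 256 * \<mu>^3 * y\<^sup>2 \<le> (2 * s - 4 * \<mu>) * cosh (4 * \<mu> * y) + M"
    using cosh_absorbs_square[of "2 * s - 4 * \<mu>" "4 * \<mu>" "256 * \<mu>^3"] s assms by auto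
  \<comment> \<open>The first summands make R^2 / (16 mu) exceed the additive constants of
    \<open>far\<close>; the product involving \<open>K\<close> is the bound on R used in
    \<open>near\<close>.\<close>
  define R0 where "R0 = \<bar>M\<bar> + 2 * s + 4 * \<mu> + 16 * \<mu> + 8 * \<mu> * (8 * \<mu> * K + 6 * \<mu>) + 1"
  have K: "K \<ge> 1" unfolding K_def by (rule cosh_real_ge_1)
  have R0: "R0 \<ge> 0" unfolding R0_def using s assms K by simp
  have far: "8 * \<mu> * (cosh (2 * \<mu> * (y - 1/2)))\<^sup>2 \<le> 4 * s * (sinh (2 * \<mu> * y))\<^sup>2 - 4 * R * \<mu> * y + R\<^sup>2 / (8 * \<mu>)"
    if R: "R \<ge> R0" and y: "y > 3/2" for R y
  proof -
    have "4 * s * (sinh (2 * \<mu> * y))\<^sup>2 = 2 * s * cosh (4 * \<mu> * y) - 2 * s"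
      using cosh_double[of "2 * \<mu> * y"] cosh_square_eq[of "2 * \<mu> * y"]
      by (simp add: algebra_simps)
    moreover have "8 * \<mu> * (cosh (2 * \<mu> * (y - 1/2)))\<^sup>2 = 4 * \<mu> + 4 * \<mu> * cosh (4 * \<mu> * (y - 1/2))"
      using cosh_double[of "2 * \<mu> * (y - 1/2)"] cosh_square_eq[of "2 * \<mu> * (y - 1/2)"]
      by (simp add: algebra_simps)
    moreover have "4 * \<mu> * cosh (4 * \<mu> * (y - 1/2)) \<le> 4 * \<mu> * cosh (4 * \<mu> * y)"
      using assms y by (intro mult_left_mono) (subst cosh_real_nonneg_le_iff, auto)
    moreover have "4 * R * \<mu> * y \<le> (2 * s - 4 * \<mu>) * cosh (4 * \<mu> * y) + \<bar>M\<bar> + R\<^sup>2 / (16 * \<mu>)"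
    \<comment> \<open>Half of R^2 / (8 mu) absorbs the linear term exactly when R >= 64 mu^2 y.
      Otherwise R is bounded by a multiple of y, and the resulting quadratic in y goes into the
      surplus of \<open>cosh\<close>. The other half of R^2 / (8 mu) is kept for the
      constants.\<close>
    proof (cases "R \<ge> 64 * \<mu>\<^sup>2 * y")
      case True
      then have "R * (64 * \<mu>\<^sup>2 * y) \<le> R * R" using R R0 by (intro mult_left_mono) auto
      then have "4 * R * \<mu> * y \<le> R\<^sup>2 / (16 * \<mu>)"
        using assms by (simp add: field_simps power2_eq_square)
      moreover have "(2 * s - 4 * \<mu>) * cosh (4 * \<mu> * y) \<ge> 0" using s by simp
      ultimately show ?thesis by linarith
    next
      case False
      then have "R * (4 * \<mu> * y) \<le> (64 * \<mu>\<^sup>2 * y) * (4 * \<mu> * y)"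
        using y assms by (intro mult_right_mono) auto
      also have "\<dots> = 256 * \<mu>^3 * y\<^sup>2" by (simp add: power2_eq_square power3_eq_cube)
      also have "\<dots> \<le> (2 * s - 4 * \<mu>) * cosh (4 * \<mu> * y) + M" using M y by simp
      moreover have "R\<^sup>2 / (16 * \<mu>) \<ge> 0" using assms by simp
      ultimately show ?thesis by (simp add: algebra_simps)
    qed
    moreover have "\<bar>M\<bar> + 2 * s + 4 * \<mu> \<le> R\<^sup>2 / (16 * \<mu>)"
    proof -
      have "8 * \<mu> * (8 * \<mu> * K + 6 * \<mu>) \<ge> 0" using K assms by simp
      then have "16 * \<mu> \<le> R" "\<bar>M\<bar> + 2 * s + 4 * \<mu> \<le> R"
        using R s assms unfolding R0_def by linarith+
      then have "16 * \<mu> * (\<bar>M\<bar> + 2 * s + 4 * \<mu>) \<le> R * R"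
        using s assms by (intro mult_mono) auto
      then show ?thesis using assms by (simp add: field_simps power2_eq_square)
    qed
    moreover have "R\<^sup>2 / (16 * \<mu>) + R\<^sup>2 / (16 * \<mu>) = R\<^sup>2 / (8 * \<mu>)" by simp
    ultimately show ?thesis by (simp add: algebra_simps)
  qed
  have near: "8 * \<mu> * R * K + 4 * R * \<mu> * y \<le> R\<^sup>2 / (8 * \<mu>)"
    if R: "R \<ge> R0" and y: "y \<le> 3/2" for R y
  proof -
    have "R \<ge> 8 * \<mu> * (8 * \<mu> * K + 6 * \<mu>)" using R s assms unfolding R0_def by linarith
    moreover have "4 * \<mu> * y \<le> 6 * \<mu>" using y assms by simp
    then have "8 * \<mu> * (8 * \<mu> * K + 4 * \<mu> * y) \<le> 8 * \<mu> * (8 * \<mu> * K + 6 * \<mu>)"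
      using assms by (intro mult_left_mono) auto
    ultimately have "R * (8 * \<mu> * (8 * \<mu> * K + 4 * \<mu> * y)) \<le> R * R"
      using R R0 by (intro mult_left_mono) auto
    then show ?thesis using assms by (simp add: field_simps power2_eq_square)
  qed
  have "cost \<mu> R p (y + 1/2) + cost \<mu> R p (1/2 - y) \<le>
    4 * s * (sinh (2 * \<mu> * y))\<^sup>2 + 2 * \<mu> * p\<^sup>2 - 4 * R * \<mu> * y + R\<^sup>2 / (8 * \<mu>)" (is "?c \<le> ?r")
    if R: "R \<ge> R0" for R p y
  proof -
    have Rn: "R \<ge> 0" using R R0 by simp
    \<comment> \<open>The total cost is even in y, and on the right only the linear term is not.
      Replacing y by |y| makes that term least favourable, so both signs are treated at
      once.\<close>
    have rhs: "4 * s * (sinh (2 * \<mu> * \<bar>y\<bar>))\<^sup>2 - 4 * R * \<mu> * \<bar>y\<bar> + R\<^sup>2 / (8 * \<mu>) + 2 * \<mu> * p\<^sup>2 \<le> ?r"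
    proof -
      have "(sinh (2 * \<mu> * \<bar>y\<bar>))\<^sup>2 = (sinh (2 * \<mu> * y))\<^sup>2" by (simp add: abs_if)
      moreover have "4 * R * \<mu> * y \<le> 4 * R * \<mu> * \<bar>y\<bar>"
        using Rn assms by (intro mult_left_mono) auto
      ultimately show ?thesis by simp
    qed
    have pp: "2 * \<mu> * p\<^sup>2 \<ge> 0" using assms by simp
    have KR: "4 * \<mu> * R * K \<ge> 0" using assms K Rn by simp
    have ss: "4 * s * (sinh (2 * \<mu> * \<bar>y\<bar>))\<^sup>2 \<ge> 0" using assms s by simp
    show ?thesis
    proof (cases "\<bar>y\<bar> > 3/2")
      case True
      have "?c = 2 * \<mu> * p\<^sup>2 + 8 * \<mu> * (cosh (2 * \<mu> * (\<bar>y\<bar> - 1/2)))\<^sup>2"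
      proof (cases "y > 0")
        case True
        moreover have "cosh (2 * \<mu> * (1/2 - y)) = cosh (2 * \<mu> * (y - 1/2))"
          using cosh_minus[of "2 * \<mu> * (y - 1/2)"] by (simp add: algebra_simps)
        ultimately show ?thesis using \<open>\<bar>y\<bar> > 3/2\<close> by (simp add: cost_def)
      next
        case False
        moreover have "cosh (2 * \<mu> * (y + 1/2)) = cosh (2 * \<mu> * (- y - 1/2))"
          using cosh_minus[of "2 * \<mu> * (y + 1/2)"] by (simp add: algebra_simps)
        ultimately show ?thesis using \<open>\<bar>y\<bar> > 3/2\<close> by (simp add: cost_def)
      qed
      then show ?thesis using far[OF R True] rhs by linarith
    next
      case False
      then have "?c \<le> 2 * \<mu> * p\<^sup>2 + 8 * \<mu> * R * K"
        using pp KR by (auto simp: cost_def K_def[symmetric])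
      then show ?thesis using near[OF R, of "\<bar>y\<bar>"] False rhs ss by linarith
    qed
  qed
  then show ?thesis using R0 unfolding s_def by blast
qed

subsection \<open>The conjugated operator at a fixed time\<close>

definition steps :: "(int ^ 'd::finite) set" where
  "steps = insert 0 (range (\<lambda>k. axis k 1) \<union> range (\<lambda>k. - axis k 1))"

lemma finite_steps: "finite steps"
  by (simp add: steps_def)

lemma steps_simps [simp]:
  "0 \<in> steps" "axis k 1 \<in> steps" "- axis k 1 \<in> steps"
  by (auto simp: steps_def)

text \<open>Translation by \<open>v\<close> matches the nonzero terms of the two sums, and the
  hypothesis keeps both sets of indices inside \<open>B\<close>, so no boundary terms arise.\<close>

lemma sum_lattice_shift:
  fixes h :: "int ^ 'd::finite \<Rightarrow> 'a::comm_monoid_add"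
  assumes "finite B" and "\<And>j. h j \<noteq> 0 \<Longrightarrow> j \<in> B \<and> j - v \<in> B"
  shows "(\<Sum>j\<in>B. h (j + v)) = (\<Sum>j\<in>B. h j)"
proof (rule sum.reindex_bij_witness_not_neutral[where S' = "{j\<in>B. h (j + v) = 0}"
      and T' = "{j\<in>B. h j = 0}" and j = "\<lambda>j. j + v" and i = "\<lambda>j. j - v"])
qed (use assms in \<open>auto, (metis add_diff_cancel_right')?\<close>)

text \<open>Time is frozen here: \<open>f\<close> is the weighted family at one instant, and
  \<open>B\<close> holds its support together with one layer of neighbours. Sums over the lattice
  become finite sums that tolerate unit shifts.\<close>

locale weighted_lattice =
  fixes \<mu> :: real and \<theta> :: "'d::finite \<Rightarrow> real"
    and B :: "(int ^ 'd) set" and f :: "int ^ 'd \<Rightarrow> complex"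
  assumes finite_B: "finite B"
    and near_support: "f j \<noteq> 0 \<Longrightarrow> v \<in> steps \<Longrightarrow> j + v \<in> B"
begin

definition pos :: "'d \<Rightarrow> int ^ 'd \<Rightarrow> real" where
  "pos k j = of_int (j $ k) + \<theta> k"

text \<open>An edge is labelled by its left end \<open>j\<close>, and the argument of
  \<open>cosh\<close> is the increment of the exponent from \<open>j\<close> to
  \<open>j + axis k 1\<close>; hence the midpoint \<open>pos k j + 1/2\<close>.\<close>

definition ch :: "'d \<Rightarrow> int ^ 'd \<Rightarrow> real" where
  "ch k j = cosh (2 * \<mu> * (pos k j + 1/2))"

definition sh :: "'d \<Rightarrow> int ^ 'd \<Rightarrow> real" where
  "sh k j = sinh (2 * \<mu> * (pos k j + 1/2))"

text \<open>
  Write \<open>\<psi>\<close> for the exponent of the weight. Conjugating \<open>u_(j+e_k) + u_(j-e_k)\<close> with \<open>exp \<psi>\<close>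
  gives the sum of the self-adjoint operator \<open>sym_part k\<close> and the anti-self-adjoint operator
  \<open>skew_part k\<close>. The shift \<open>\<theta>\<close> is \<open>R t (1 - t)\<close> in the direction \<open>k1\<close> and \<open>0\<close> in all others.
\<close>

definition sym_part :: "'d \<Rightarrow> int ^ 'd \<Rightarrow> complex" where
  "sym_part k j = ch k j *\<^sub>R f (j + axis k 1) + ch k (j - axis k 1) *\<^sub>R f (j - axis k 1)"

definition skew_part :: "'d \<Rightarrow> int ^ 'd \<Rightarrow> complex" where
  "skew_part k j = sh k (j - axis k 1) *\<^sub>R f (j - axis k 1) - sh k j *\<^sub>R f (j + axis k 1)"

lemma pos_axis [simp]:
  "pos k (j + axis k 1) = pos k j + 1" "pos k (j - axis k 1) = pos k j - 1"
  "k \<noteq> l \<Longrightarrow> pos k (j + axis l 1) = pos k j" "k \<noteq> l \<Longrightarrow> pos k (j - axis l 1) = pos k j"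
  by (auto simp: pos_def axis_def)

lemma ch_sh_other [simp]:
  assumes "k \<noteq> l"
  shows "ch k (j + axis l 1) = ch k j" "ch k (j - axis l 1) = ch k j"
    "sh k (j + axis l 1) = sh k j" "sh k (j - axis l 1) = sh k j"
  using assms by (auto simp: ch_def sh_def)

lemma in_B:
  assumes "f j \<noteq> 0"
  shows "j \<in> B" "j + axis k 1 \<in> B" "j - axis k 1 \<in> B"
  using near_support[OF assms, of 0] near_support[OF assms, of "axis k 1"]
    near_support[OF assms, of "- axis k 1"]
  by simp_all

lemma sum_shift_axis:
  fixes h :: "int ^ 'd \<Rightarrow> real"
  assumes "\<And>j. h j \<noteq> 0 \<Longrightarrow> f j \<noteq> 0 \<or> f (j - axis k 1) \<noteq> 0"
  shows "(\<Sum>j\<in>B. h (j + axis k 1)) = (\<Sum>j\<in>B. h j)"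
proof (rule sum_lattice_shift[OF finite_B])
  fix j assume "h j \<noteq> 0"
  from assms[OF this] show "j \<in> B \<and> j - axis k 1 \<in> B"
    using in_B(1)[of j] in_B(3)[of j k] in_B(1)[of "j - axis k 1"] in_B(2)[of "j - axis k 1" k] by auto
qed

section \<open>Summation by parts for the symmetric and skew parts\<close>

text \<open>Shifting the terms with \<open>u (j + axis k 1)\<close> gathers all of \<open>u\<close>
  at \<open>j\<close>. This turns the time derivative of the energy, written edge by edge, into a
  pairing with the skew part. Every term has a factor \<open>f\<close>, so \<open>u\<close> may be
  arbitrary.\<close>

lemma sum_skew_energy:
  "(\<Sum>j\<in>B. sh k j * Im (u (j + axis k 1) * cnj (f j) + f (j + axis k 1) * cnj (u j)))
   = (\<Sum>j\<in>B. Re (u j * cnj (\<i> * skew_part k j)))"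
proof -
  have "(\<Sum>j\<in>B. sh k j * Im (u (j + axis k 1) * cnj (f j)))
      = (\<Sum>j\<in>B. sh k (j - axis k 1) * Im (u j * cnj (f (j - axis k 1))))"
    using sum_shift_axis[of "\<lambda>j. sh k (j - axis k 1) * Im (u j * cnj (f (j - axis k 1)))" k]
    by fastforce
  then show ?thesis
    by (simp add: skew_part_def algebra_simps sum.distrib sum_subtractf)
qed

text \<open>This is the commutator of multiplication by \<open>w\<close> with the self-adjoint part:
  the two ends of an edge contribute with opposite signs, which leaves the difference of
  \<open>w\<close> along it.\<close>

lemma sum_sym_weight:
  "(\<Sum>j\<in>B. w j * Re (\<i> * sym_part k j * cnj (f j)))
   = (\<Sum>j\<in>B. (w (j + axis k 1) - w j) * ch k j * Im (f (j + axis k 1) * cnj (f j)))"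
proof -
  have "(\<Sum>j\<in>B. w (j + axis k 1) * ch k j * Im (f j * cnj (f (j + axis k 1))))
      = (\<Sum>j\<in>B. w j * ch k (j - axis k 1) * Im (f (j - axis k 1) * cnj (f j)))"
    using sum_shift_axis[of "\<lambda>j. w j * ch k (j - axis k 1) * Im (f (j - axis k 1) * cnj (f j))" k]
    by fastforce
  then show ?thesis
    by (simp add: sym_part_def algebra_simps sum.distrib sum_subtractf)
qed

text \<open>Anti-self-adjointness in quadratic form; it removes the constant diagonal of the
  Laplacian from the commutator.\<close>

lemma sum_skew_zero: "(\<Sum>j\<in>B. Re (f j * cnj (skew_part k j))) = 0"
proof -
  have "(\<Sum>j\<in>B. sh k j * Re (f (j + axis k 1) * cnj (f j)))
      = (\<Sum>j\<in>B. sh k (j - axis k 1) * Re (f j * cnj (f (j - axis k 1))))"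
    using sum_shift_axis[of "\<lambda>j. sh k (j - axis k 1) * Re (f j * cnj (f (j - axis k 1)))" k]
    by fastforce
  then show ?thesis
    by (simp add: skew_part_def algebra_simps sum.distrib sum_subtractf)
qed

text \<open>Different directions commute, since the coefficients in direction \<open>k\<close> do
  not vary in direction \<open>l\<close>. The four products cancel in pairs after shifts by e_k +
  e_l and by e_k - e_l.\<close>

lemma sum_sym_skew_other:
  assumes "k \<noteq> l"
  shows "(\<Sum>j\<in>B. Re (sym_part k j * cnj (skew_part l j))) = 0"
proof -
  let ?k = "axis k 1 :: int ^ 'd" and ?l = "axis l 1 :: int ^ 'd"
  have neq: "l \<noteq> k" using assms by simp
  have 1: "(\<Sum>j\<in>B. ch k j * sh l j * Re (f (j + ?k) * cnj (f (j + ?l))))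
      = (\<Sum>j\<in>B. ch k (j - ?k) * sh l (j - ?l) * Re (f (j - ?k) * cnj (f (j - ?l))))" (is "_ = sum ?h B")
  proof -
    have "sum ?h B = (\<Sum>j\<in>B. ?h (j + (?k + ?l)))"
    proof (rule sum_lattice_shift[OF finite_B, symmetric])
      fix j assume "?h j \<noteq> 0"
      then have "f (j - ?k) \<noteq> 0" by auto
      \<comment> \<open>Both points are neighbours of \<open>j - axis k 1\<close>, so one layer
        around the support suffices even for a diagonal shift.\<close>
      from in_B(2)[OF this, of k] in_B(3)[OF this, of l] show "j \<in> B \<and> j - (?k + ?l) \<in> B"
        by (simp add: algebra_simps)
    qed
    also have "\<dots> = (\<Sum>j\<in>B. ch k j * sh l j * Re (f (j + ?k) * cnj (f (j + ?l))))"
    proof (rule sum.cong[OF refl])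
      fix j
      have e: "j + (?k + ?l) - ?k = j + ?l" "j + (?k + ?l) - ?l = j + ?k"
        by (simp_all add: algebra_simps)
      show "?h (j + (?k + ?l)) = ch k j * sh l j * Re (f (j + ?k) * cnj (f (j + ?l)))"
        unfolding e using assms neq by (simp add: algebra_simps)
    qed
    finally show ?thesis by simp
  qed
  have 2: "(\<Sum>j\<in>B. ch k j * sh l (j - ?l) * Re (f (j + ?k) * cnj (f (j - ?l))))
      = (\<Sum>j\<in>B. ch k (j - ?k) * sh l j * Re (f (j - ?k) * cnj (f (j + ?l))))" (is "_ = sum ?h B")
  proof -
    have "sum ?h B = (\<Sum>j\<in>B. ?h (j + (?k - ?l)))"
    proof (rule sum_lattice_shift[OF finite_B, symmetric])
      fix j assume "?h j \<noteq> 0"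
      then have "f (j - ?k) \<noteq> 0" by auto
      from in_B(2)[OF this, of k] in_B(2)[OF this, of l] show "j \<in> B \<and> j - (?k - ?l) \<in> B"
        by (simp add: algebra_simps)
    qed
    also have "\<dots> = (\<Sum>j\<in>B. ch k j * sh l (j - ?l) * Re (f (j + ?k) * cnj (f (j - ?l))))"
    proof (rule sum.cong[OF refl])
      fix j
      have e: "j + (?k - ?l) - ?k = j - ?l" "j + (?k - ?l) + ?l = j + ?k"
        by (simp_all add: algebra_simps)
      have e': "j + (?k - ?l) = (j - ?l) + ?k" by (simp add: algebra_simps)
      have s: "sh l (j + (?k - ?l)) = sh l (j - ?l)"
        unfolding e' using assms neq by simp
      show "?h (j + (?k - ?l)) = ch k j * sh l (j - ?l) * Re (f (j + ?k) * cnj (f (j - ?l)))"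
        unfolding e s using assms neq by (simp add: algebra_simps)
    qed
    finally show ?thesis by simp
  qed
  have "(\<Sum>j\<in>B. Re (sym_part k j * cnj (skew_part l j)))
     = (\<Sum>j\<in>B. ch k j * sh l (j - ?l) * Re (f (j + ?k) * cnj (f (j - ?l))))
     - (\<Sum>j\<in>B. ch k j * sh l j * Re (f (j + ?k) * cnj (f (j + ?l))))
     + (\<Sum>j\<in>B. ch k (j - ?k) * sh l (j - ?l) * Re (f (j - ?k) * cnj (f (j - ?l))))
     - (\<Sum>j\<in>B. ch k (j - ?k) * sh l j * Re (f (j - ?k) * cnj (f (j + ?l))))"
    unfolding sum.distrib[symmetric] sum_subtractf[symmetric]
    by (rule sum.cong[OF refl]) (simp add: sym_part_def skew_part_def algebra_simps)
  then show ?thesis using 1 2 by simp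
qed

text \<open>The product contains squares of \<open>f\<close> at both neighbours of \<open>j\<close>
  and a mixed term with coefficient -2 sinh(2 mu). After bounding the mixed term by squares and
  shifting them back to \<open>j\<close>, the coefficient is sinh(4 mu (y + 1/2)) - sinh(4 mu (y -
  1/2)) - 2 sinh(2 mu), which the hyperbolic identities turn into the one claimed.\<close>

lemma sum_sym_skew_same:
  assumes "\<mu> > 0"
  shows "4 * sinh (2 * \<mu>) * (\<Sum>j\<in>B. (sinh (2 * \<mu> * pos k j))\<^sup>2 * (norm (f j))\<^sup>2)
    \<le> 2 * (\<Sum>j\<in>B. Re (sym_part k j * cnj (skew_part k j)))"
proof -
  let ?k = "axis k 1 :: int ^ 'd" and ?s = "sinh (2 * \<mu>)"
  let ?n = "\<lambda>j. (norm (f j))\<^sup>2"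
  let ?p = "\<lambda>j. sinh (4 * \<mu> * (pos k j + 1/2))" and ?m = "\<lambda>j. sinh (4 * \<mu> * (pos k j - 1/2))"
  have s: "?s \<ge> 0" using assms by simp
  have right: "(\<Sum>j\<in>B. (?s + ?p j) * ?n (j + ?k)) = (\<Sum>j\<in>B. (?s + ?m j) * ?n j)"
    using sum_shift_axis[of "\<lambda>j. (?s + ?m j) * ?n j" k] by (fastforce simp: algebra_simps)
  have left: "(\<Sum>j\<in>B. (?s - ?p j) * ?n j) = (\<Sum>j\<in>B. (?s - ?m j) * ?n (j - ?k))"
    using sum_shift_axis[of "\<lambda>j. (?s - ?m j) * ?n (j - ?k)" k] by (fastforce simp: algebra_simps)
  have pw: "- ((?s + ?p j) * ?n (j + ?k)) - (?s - ?m j) * ?n (j - ?k)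
      \<le> 2 * Re (sym_part k j * cnj (skew_part k j))" for j
  proof -
    define a b where "a = f (j + ?k)" and "b = f (j - ?k)"
    define x where "x = pos k j"
    have p: "?p j = 2 * sh k j * ch k j"
      using sinh_double[of "2 * \<mu> * (pos k j + 1/2)"] by (simp add: sh_def ch_def algebra_simps)
    have m: "?m j = 2 * sh k (j - ?k) * ch k (j - ?k)"
      using sinh_double[of "2 * \<mu> * (pos k j - 1/2)"] by (simp add: sh_def ch_def algebra_simps)
    have s': "?s = sh k j * ch k (j - ?k) - ch k j * sh k (j - ?k)"
      using sinh_diff[of "2 * \<mu> * (pos k j + 1/2)" "2 * \<mu> * (pos k j - 1/2)"]
      by (simp add: sh_def ch_def algebra_simps)
    have "2 * Re (sym_part k j * cnj (skew_part k j)) =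
        - ?p j * (norm a)\<^sup>2 + ?m j * (norm b)\<^sup>2 - 2 * ?s * Re (a * cnj b)"
      unfolding p m s' unfolding sym_part_def skew_part_def a_def[symmetric] b_def[symmetric] cmod_power2
      by (simp add: algebra_simps power2_eq_square)
    moreover have "2 * Re (a * cnj b) \<le> (norm a)\<^sup>2 + (norm b)\<^sup>2"
    proof -
      have "Re (a * cnj b) \<le> norm a * norm b"
        by (metis complex_Re_le_cmod complex_mod_cnj norm_mult)
      moreover have "2 * norm a * norm b \<le> (norm a)\<^sup>2 + (norm b)\<^sup>2"
        by (rule sum_squares_bound)
      ultimately show ?thesis by linarith
    qed
    then have "?s * (2 * Re (a * cnj b)) \<le> ?s * ((norm a)\<^sup>2 + (norm b)\<^sup>2)"
      using s by (rule mult_left_mono)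
    ultimately show ?thesis
      unfolding a_def[symmetric] b_def[symmetric] by (simp add: algebra_simps)
  qed
  have coeff: "?p j - ?m j - 2 * ?s = 4 * ?s * (sinh (2 * \<mu> * pos k j))\<^sup>2" for j
  proof -
    have "?p j - ?m j = 2 * cosh (4 * \<mu> * pos k j) * ?s"
      using sinh_add[of "4 * \<mu> * pos k j" "2 * \<mu>"] sinh_diff[of "4 * \<mu> * pos k j" "2 * \<mu>"]
      by (simp add: algebra_simps)
    moreover have "cosh (4 * \<mu> * pos k j) = 1 + 2 * (sinh (2 * \<mu> * pos k j))\<^sup>2"
      using cosh_double[of "2 * \<mu> * pos k j"] cosh_square_eq[of "2 * \<mu> * pos k j"]
      by (simp add: algebra_simps)
    ultimately show ?thesis by (simp add: algebra_simps)
  qed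
  have "4 * ?s * (\<Sum>j\<in>B. (sinh (2 * \<mu> * pos k j))\<^sup>2 * ?n j) = (\<Sum>j\<in>B. (?p j - ?m j - 2 * ?s) * ?n j)"
    unfolding coeff by (simp add: sum_distrib_left algebra_simps)
  also have "\<dots> = (\<Sum>j\<in>B. - ((?s - ?p j) * ?n j) - (?s + ?m j) * ?n j)"
    by (rule sum.cong[OF refl]) (simp add: algebra_simps)
  also have "\<dots> = - (\<Sum>j\<in>B. (?s - ?p j) * ?n j) - (\<Sum>j\<in>B. (?s + ?m j) * ?n j)"
    by (simp only: sum_subtractf sum_negf)
  also have "\<dots> = (\<Sum>j\<in>B. - ((?s + ?p j) * ?n (j + ?k)) - (?s - ?m j) * ?n (j - ?k))"
    by (simp only: left right[symmetric] sum_subtractf sum_negf)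
  also have "\<dots> \<le> (\<Sum>j\<in>B. 2 * Re (sym_part k j * cnj (skew_part k j)))"
    by (intro sum_mono pw)
  finally show ?thesis by (simp add: sum_distrib_left)
qed

section \<open>The commutator and the derivative of the energy\<close>

text \<open>Only three kinds of pairing occur: with \<open>w\<close>, between symmetric and skew
  parts, and with the constant \<open>c\<close>. The last vanishes, and so do the mixed directions.
  The diagonal directions have nonnegative lower bounds, of which only that for \<open>k0\<close> is
  kept.\<close>

lemma sum_commutator:
  assumes "\<mu> > 0"
  shows "2 * (\<Sum>j\<in>B. \<Sum>k\<in>UNIV. (w (j + axis k 1) - w j) * ch k j * Im (f (j + axis k 1) * cnj (f j)))
      + 4 * sinh (2 * \<mu>) * (\<Sum>j\<in>B. (sinh (2 * \<mu> * pos k0 j))\<^sup>2 * (norm (f j))\<^sup>2)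
    \<le> (\<Sum>j\<in>B. 2 * Re (\<i> * ((\<Sum>k\<in>UNIV. sym_part k j) - c *\<^sub>R f j)
        * cnj (w j *\<^sub>R f j + \<i> * (\<Sum>k\<in>UNIV. skew_part k j))))"
proof -
  let ?N = "\<lambda>k. 4 * sinh (2 * \<mu>) * (\<Sum>j\<in>B. (sinh (2 * \<mu> * pos k j))\<^sup>2 * (norm (f j))\<^sup>2)"
  have N: "?N k \<ge> 0" for k
    using assms by (intro mult_nonneg_nonneg sum_nonneg) auto
  have pointwise: "2 * Re (\<i> * ((\<Sum>k\<in>UNIV. sym_part k j) - c *\<^sub>R f j)
        * cnj (w j *\<^sub>R f j + \<i> * (\<Sum>k\<in>UNIV. skew_part k j)))
      = 2 * (\<Sum>k\<in>UNIV. w j * Re (\<i> * sym_part k j * cnj (f j)))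
        + 2 * (\<Sum>k\<in>UNIV. \<Sum>l\<in>UNIV. Re (sym_part k j * cnj (skew_part l j)))
        - 2 * c * (\<Sum>l\<in>UNIV. Re (f j * cnj (skew_part l j)))" for j
  proof -
    define P Q where "P = (\<Sum>k\<in>UNIV. sym_part k j)" and "Q = (\<Sum>k\<in>UNIV. skew_part k j)"
    have 1: "(\<Sum>k\<in>UNIV. w j * Re (\<i> * sym_part k j * cnj (f j))) = w j * Re (\<i> * P * cnj (f j))"
      by (simp add: P_def sum_distrib_left sum_distrib_right)
    have 2: "(\<Sum>k\<in>UNIV. \<Sum>l\<in>UNIV. Re (sym_part k j * cnj (skew_part l j))) = Re (P * cnj Q)"
      unfolding P_def Q_def cnj_sum sum_product Re_sum ..
    have 3: "(\<Sum>l\<in>UNIV. Re (f j * cnj (skew_part l j))) = Re (f j * cnj Q)"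
      unfolding Q_def cnj_sum sum_distrib_left Re_sum ..
    show ?thesis
      unfolding 1 2 3 unfolding P_def[symmetric] Q_def[symmetric] by (simp add: algebra_simps)
  qed
  have sym_skew: "(\<Sum>k\<in>UNIV. \<Sum>l\<in>UNIV. \<Sum>j\<in>B. Re (sym_part k j * cnj (skew_part l j)))
      = (\<Sum>k\<in>UNIV. \<Sum>j\<in>B. Re (sym_part k j * cnj (skew_part k j)))"
  proof (rule sum.cong[OF refl])
    fix k
    show "(\<Sum>l\<in>UNIV. \<Sum>j\<in>B. Re (sym_part k j * cnj (skew_part l j))) = (\<Sum>j\<in>B. Re (sym_part k j * cnj (skew_part k j)))"
      using sum_sym_skew_other[of k]
      by (subst sum.remove[of _ k]) (auto intro!: sum.neutral)
  qed
  have "(\<Sum>j\<in>B. 2 * Re (\<i> * ((\<Sum>k\<in>UNIV. sym_part k j) - c *\<^sub>R f j)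
        * cnj (w j *\<^sub>R f j + \<i> * (\<Sum>k\<in>UNIV. skew_part k j))))
      = 2 * (\<Sum>k\<in>UNIV. \<Sum>j\<in>B. w j * Re (\<i> * sym_part k j * cnj (f j)))
        + 2 * (\<Sum>k\<in>UNIV. \<Sum>l\<in>UNIV. \<Sum>j\<in>B. Re (sym_part k j * cnj (skew_part l j)))
        - 2 * c * (\<Sum>l\<in>UNIV. \<Sum>j\<in>B. Re (f j * cnj (skew_part l j)))"
    unfolding pointwise sum.distrib sum_subtractf
      sum_distrib_left[where r = 2, symmetric] sum_distrib_left[where r = "2 * c", symmetric]
    by (simp only: sum.swap[where A = B])
  also have "\<dots> = 2 * (\<Sum>k\<in>UNIV. \<Sum>j\<in>B. (w (j + axis k 1) - w j) * ch k j * Im (f (j + axis k 1) * cnj (f j)))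
      + (\<Sum>k\<in>UNIV. 2 * (\<Sum>j\<in>B. Re (sym_part k j * cnj (skew_part k j))))"
    unfolding sym_skew sum_sym_weight sum_skew_zero by (simp add: sum_distrib_left)
  finally have eq: "(\<Sum>j\<in>B. 2 * Re (\<i> * ((\<Sum>k\<in>UNIV. sym_part k j) - c *\<^sub>R f j)
        * cnj (w j *\<^sub>R f j + \<i> * (\<Sum>k\<in>UNIV. skew_part k j)))) = \<dots>" .
  have "?N k0 \<le> (\<Sum>k\<in>UNIV. ?N k)"
    using N by (intro member_le_sum) auto
  also have "\<dots> \<le> (\<Sum>k\<in>UNIV. 2 * (\<Sum>j\<in>B. Re (sym_part k j * cnj (skew_part k j))))"
    by (intro sum_mono sum_sym_skew_same assms)
  finally show ?thesis
    unfolding eq by (subst sum.swap) simp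
qed

text \<open>With \<open>u\<close> as the time derivative of \<open>f\<close>, the right-hand side is
  the part of H' in which \<open>f\<close> is differentiated and the coefficients are not. It equals
  2 Re <u, S f>; the pairing with \<open>K\<close> is the commutator, and the rest is bounded by
  completing a square.\<close>

lemma energy_derivative_bound:
  assumes "\<mu> > 0"
    and u: "\<And>j. u j = F j + w j *\<^sub>R f j + \<i> * ((\<Sum>k\<in>UNIV. sym_part k j + skew_part k j) - c *\<^sub>R f j)"
  shows "2 * (\<Sum>j\<in>B. \<Sum>k\<in>UNIV. (w (j + axis k 1) - w j) * ch k j * Im (f (j + axis k 1) * cnj (f j)))
      + 4 * sinh (2 * \<mu>) * (\<Sum>j\<in>B. (sinh (2 * \<mu> * pos k0 j))\<^sup>2 * (norm (f j))\<^sup>2)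
      - (\<Sum>j\<in>B. (norm (F j))\<^sup>2) / 2
    \<le> (\<Sum>j\<in>B. 2 * w j * Re (u j * cnj (f j))
        + 2 * (\<Sum>k\<in>UNIV. sh k j * Im (u (j + axis k 1) * cnj (f j) + f (j + axis k 1) * cnj (u j))))"
proof -
  define S where "S j = w j *\<^sub>R f j + \<i> * (\<Sum>k\<in>UNIV. skew_part k j)" for j
  define K where "K j = \<i> * ((\<Sum>k\<in>UNIV. sym_part k j) - c *\<^sub>R f j)" for j
  have u': "u j = F j + S j + K j" for j
    unfolding u S_def K_def by (simp add: sum.distrib algebra_simps)
  have "(\<Sum>j\<in>B. \<Sum>k\<in>UNIV. sh k j * Im (u (j + axis k 1) * cnj (f j) + f (j + axis k 1) * cnj (u j)))
      = (\<Sum>k\<in>UNIV. \<Sum>j\<in>B. Re (u j * cnj (\<i> * skew_part k j)))"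
    unfolding sum_skew_energy[symmetric] by (rule sum.swap)
  also have "\<dots> = (\<Sum>j\<in>B. \<Sum>k\<in>UNIV. Re (u j * cnj (\<i> * skew_part k j)))"
    by (rule sum.swap)
  also have "\<dots> = (\<Sum>j\<in>B. Re (u j * cnj (\<i> * (\<Sum>k\<in>UNIV. skew_part k j))))"
    unfolding sum_distrib_left cnj_sum Re_sum ..
  finally have "(\<Sum>j\<in>B. 2 * w j * Re (u j * cnj (f j))
        + 2 * (\<Sum>k\<in>UNIV. sh k j * Im (u (j + axis k 1) * cnj (f j) + f (j + axis k 1) * cnj (u j))))
      = (\<Sum>j\<in>B. 2 * w j * Re (u j * cnj (f j)) + 2 * Re (u j * cnj (\<i> * (\<Sum>k\<in>UNIV. skew_part k j))))"
    by (simp only: sum.distrib sum_distrib_left[symmetric])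
  also have "\<dots> = (\<Sum>j\<in>B. 2 * Re (u j * cnj (S j)))"
    by (rule sum.cong[OF refl]) (simp add: S_def algebra_simps)
  also have "\<dots> = (\<Sum>j\<in>B. 2 * Re (F j * cnj (S j)) + 2 * (norm (S j))\<^sup>2) + (\<Sum>j\<in>B. 2 * Re (K j * cnj (S j)))"
    unfolding sum.distrib[symmetric] u' cmod_power2
    by (rule sum.cong[OF refl]) (simp add: algebra_simps power2_eq_square)
  finally have eq: "(\<Sum>j\<in>B. 2 * w j * Re (u j * cnj (f j))
        + 2 * (\<Sum>k\<in>UNIV. sh k j * Im (u (j + axis k 1) * cnj (f j) + f (j + axis k 1) * cnj (u j)))) = \<dots>" .
  have "- (norm (F j))\<^sup>2 / 2 \<le> 2 * Re (F j * cnj (S j)) + 2 * (norm (S j))\<^sup>2" for j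
  proof -
    have "0 \<le> (norm (F j + 2 *\<^sub>R S j))\<^sup>2 / 2" by simp
    also have "\<dots> = (norm (F j))\<^sup>2 / 2 + 2 * Re (F j * cnj (S j)) + 2 * (norm (S j))\<^sup>2"
      unfolding cmod_power2 by (simp add: algebra_simps power2_eq_square add_divide_distrib)
    finally show ?thesis by simp
  qed
  then have "(\<Sum>j\<in>B. - (norm (F j))\<^sup>2 / 2) \<le> (\<Sum>j\<in>B. 2 * Re (F j * cnj (S j)) + 2 * (norm (S j))\<^sup>2)"
    by (rule sum_mono)
  moreover have "(\<Sum>j\<in>B. - (norm (F j))\<^sup>2 / 2) = - (\<Sum>j\<in>B. (norm (F j))\<^sup>2) / 2"
    by (simp only: sum_negf sum_divide_distrib[symmetric])
  ultimately show ?thesis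
    using sum_commutator[OF assms(1), of w k0 c]
    unfolding eq K_def[symmetric] S_def[symmetric] by linarith
qed

text \<open>Each edge is charged to its two ends. Shifting the charges of the right ends collects
  both costs at every point, where the hypothesis on \<open>cost\<close> bounds them.\<close>

lemma cross_term_absorbed:
  assumes "\<mu> > 0" "\<bar>p\<bar> \<le> R"
    and cost: "\<And>y. cost \<mu> R p (y + 1/2) + cost \<mu> R p (1/2 - y) \<le>
      4 * sinh (2 * \<mu>) * (sinh (2 * \<mu> * y))\<^sup>2 + 2 * \<mu> * p\<^sup>2 - 4 * R * \<mu> * y + R\<^sup>2 / (8 * \<mu>)"
  shows "0 \<le> (\<Sum>j\<in>B. 8 * \<mu> * p * ch k j * Im (f (j + axis k 1) * cnj (f j)))
    + (\<Sum>j\<in>B. (4 * sinh (2 * \<mu>) * (sinh (2 * \<mu> * pos k j))\<^sup>2 + 2 * \<mu> * p\<^sup>2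
        - 4 * R * \<mu> * pos k j + R\<^sup>2 / (8 * \<mu>)) * (norm (f j))\<^sup>2)"
proof -
  let ?n = "\<lambda>j. (norm (f j))\<^sup>2"
  have shift: "(\<Sum>j\<in>B. cost \<mu> R p (- (pos k j + 1/2)) * ?n (j + axis k 1))
      = (\<Sum>j\<in>B. cost \<mu> R p (1/2 - pos k j) * ?n j)"
    using sum_shift_axis[of "\<lambda>j. cost \<mu> R p (1/2 - pos k j) * ?n j" k] by (fastforce simp: algebra_simps)
  have "- (8 * \<mu> * p * ch k j * Im (f (j + axis k 1) * cnj (f j)))
      \<le> cost \<mu> R p (pos k j + 1/2) * ?n j + cost \<mu> R p (- (pos k j + 1/2)) * ?n (j + axis k 1)" for j
  proof -
    let ?a = "Im (f (j + axis k 1) * cnj (f j))"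
    have "\<bar>?a\<bar> \<le> norm (f j) * norm (f (j + axis k 1))"
      using abs_Im_le_cmod[of "f (j + axis k 1) * cnj (f j)"] by (simp add: norm_mult mult.commute)
    then have "8 * \<mu> * \<bar>p\<bar> * ch k j * \<bar>?a\<bar> \<le> 8 * \<mu> * \<bar>p\<bar> * ch k j * (norm (f j) * norm (f (j + axis k 1)))"
      using assms by (intro mult_left_mono) (auto simp: ch_def)
    moreover have "- (8 * \<mu> * p * ch k j * ?a) \<le> 8 * \<mu> * \<bar>p\<bar> * ch k j * \<bar>?a\<bar>"
    proof -
      have "ch k j \<ge> 0" by (simp add: ch_def)
      then have "8 * \<mu> * \<bar>p\<bar> * ch k j * \<bar>?a\<bar> = \<bar>8 * \<mu> * p * ch k j * ?a\<bar>"
        using assms by (simp add: abs_mult)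
      then show ?thesis by linarith
    qed
    ultimately show ?thesis
      using cross_term_cost[OF assms(1,2), of "norm (f j)" "norm (f (j + axis k 1))" "pos k j + 1/2"]
      unfolding ch_def by simp
  qed
  then have "(\<Sum>j\<in>B. - (8 * \<mu> * p * ch k j * Im (f (j + axis k 1) * cnj (f j))))
      \<le> (\<Sum>j\<in>B. cost \<mu> R p (pos k j + 1/2) * ?n j + cost \<mu> R p (- (pos k j + 1/2)) * ?n (j + axis k 1))"
    by (rule sum_mono)
  also have "\<dots> = (\<Sum>j\<in>B. (cost \<mu> R p (pos k j + 1/2) + cost \<mu> R p (1/2 - pos k j)) * ?n j)"
    unfolding sum.distrib shift distrib_right ..
  also have "\<dots> \<le> (\<Sum>j\<in>B. (4 * sinh (2 * \<mu>) * (sinh (2 * \<mu> * pos k j))\<^sup>2 + 2 * \<mu> * p\<^sup>2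
        - 4 * R * \<mu> * pos k j + R\<^sup>2 / (8 * \<mu>)) * ?n j)"
    by (intro sum_mono mult_right_mono cost) auto
  finally show ?thesis by (simp add: sum_negf)
qed

lemma energy_derivative_coercive:
  assumes "\<mu> > 0" "\<bar>p\<bar> \<le> R"
    and cost: "\<And>y. cost \<mu> R p (y + 1/2) + cost \<mu> R p (1/2 - y) \<le>
      4 * sinh (2 * \<mu>) * (sinh (2 * \<mu> * y))\<^sup>2 + 2 * \<mu> * p\<^sup>2 - 4 * R * \<mu> * y + R\<^sup>2 / (8 * \<mu>)"
    and u: "\<And>j. u j = F j + w j *\<^sub>R f j + \<i> * ((\<Sum>k\<in>UNIV. sym_part k j + skew_part k j) - c *\<^sub>R f j)"
    and w: "\<And>j k. w (j + axis k 1) - w j = (if k = k1 then 2 * \<mu> * p else 0)"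
    and w': "\<And>j. w' j = 2 * \<mu> * p\<^sup>2 - 4 * R * \<mu> * pos k1 j + R\<^sup>2 / (8 * \<mu>) + b"
  shows "b * (\<Sum>j\<in>B. (norm (f j))\<^sup>2) - (\<Sum>j\<in>B. (norm (F j))\<^sup>2) / 2
    \<le> (\<Sum>j\<in>B. w' j * (norm (f j))\<^sup>2 + 2 * w j * Re (u j * cnj (f j))
        + 2 * (\<Sum>k\<in>UNIV. (if k = k1 then 2 * \<mu> * p * ch k j else 0) * Im (f (j + axis k 1) * cnj (f j))
          + sh k j * Im (u (j + axis k 1) * cnj (f j) + f (j + axis k 1) * cnj (u j))))"
proof -
  let ?I = "\<Sum>j\<in>B. 2 * \<mu> * p * ch k1 j * Im (f (j + axis k1 1) * cnj (f j))"
  have if_sum: "(\<Sum>k\<in>UNIV. (if k = k1 then g k else 0) * h k) = g k1 * h k1" for g h :: "'d \<Rightarrow> real"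
  proof -
    have "(\<Sum>k\<in>UNIV. (if k = k1 then g k else 0) * h k) = (\<Sum>k\<in>UNIV. if k = k1 then g k * h k else 0)"
      by (rule sum.cong) auto
    then show ?thesis by simp
  qed
  have "2 * ?I + 4 * sinh (2 * \<mu>) * (\<Sum>j\<in>B. (sinh (2 * \<mu> * pos k1 j))\<^sup>2 * (norm (f j))\<^sup>2)
      - (\<Sum>j\<in>B. (norm (F j))\<^sup>2) / 2
    \<le> (\<Sum>j\<in>B. 2 * w j * Re (u j * cnj (f j))
        + 2 * (\<Sum>k\<in>UNIV. sh k j * Im (u (j + axis k 1) * cnj (f j) + f (j + axis k 1) * cnj (u j))))"
    using energy_derivative_bound[OF assms(1) u, of k1] unfolding w mult.assoc if_sum
    by simp
  moreover have "(\<Sum>j\<in>B. w' j * (norm (f j))\<^sup>2 + 2 * w j * Re (u j * cnj (f j))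
        + 2 * (\<Sum>k\<in>UNIV. (if k = k1 then 2 * \<mu> * p * ch k j else 0) * Im (f (j + axis k 1) * cnj (f j))
          + sh k j * Im (u (j + axis k 1) * cnj (f j) + f (j + axis k 1) * cnj (u j))))
    = (\<Sum>j\<in>B. w' j * (norm (f j))\<^sup>2) + 2 * ?I + (\<Sum>j\<in>B. 2 * w j * Re (u j * cnj (f j))
        + 2 * (\<Sum>k\<in>UNIV. sh k j * Im (u (j + axis k 1) * cnj (f j) + f (j + axis k 1) * cnj (u j))))"
    unfolding sum.distrib if_sum distrib_left sum_distrib_left by (simp only: ac_simps)
  \<comment> \<open>The cross term arises twice in equal amounts: from the commutator with
    \<open>w\<close> and from differentiating the \<open>sinh\<close> coefficients of the
    energy.\<close>
  moreover have "(\<Sum>j\<in>B. 8 * \<mu> * p * ch k1 j * Im (f (j + axis k1 1) * cnj (f j))) = 4 * ?I"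
    by (simp add: sum_distrib_left algebra_simps)
  moreover have "(\<Sum>j\<in>B. (4 * sinh (2 * \<mu>) * (sinh (2 * \<mu> * pos k1 j))\<^sup>2 + 2 * \<mu> * p\<^sup>2
        - 4 * R * \<mu> * pos k1 j + R\<^sup>2 / (8 * \<mu>)) * (norm (f j))\<^sup>2)
      = 4 * sinh (2 * \<mu>) * (\<Sum>j\<in>B. (sinh (2 * \<mu> * pos k1 j))\<^sup>2 * (norm (f j))\<^sup>2)
        + (\<Sum>j\<in>B. w' j * (norm (f j))\<^sup>2) - b * (\<Sum>j\<in>B. (norm (f j))\<^sup>2)"
    unfolding sum_distrib_left sum.distrib[symmetric] sum_subtractf[symmetric] w'
    by (rule sum.cong[OF refl]) (simp add: algebra_simps)
  ultimately show ?thesis using cross_term_absorbed[OF assms(1-3), of k1] by linarith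
qed

end

subsection \<open>Integration in time\<close>

lemma L2_l2_norm_finite:
  fixes h :: "int ^ 'd::finite \<Rightarrow> real \<Rightarrow> complex"
  assumes "finite B" and zero: "\<And>j t. j \<notin> B \<Longrightarrow> t \<in> {0..1} \<Longrightarrow> h j t = 0"
    and cont: "\<And>j. continuous_on {0..1} (h j)"
  shows "L2_l2_norm h = sqrt (integral {0..1} (\<lambda>t. \<Sum>j\<in>B. (norm (h j t))\<^sup>2))"
proof -
  have "(\<Sum>\<^sub>\<infinity>j. (norm (h j t))\<^sup>2) = (\<Sum>j\<in>B. (norm (h j t))\<^sup>2)" if "t \<in> {0..1}" for t
  proof -
    have "(\<Sum>\<^sub>\<infinity>j. (norm (h j t))\<^sup>2) = (\<Sum>\<^sub>\<infinity>j\<in>B. (norm (h j t))\<^sup>2)"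
      using zero that by (intro infsum_cong_neutral) auto
    then show ?thesis using assms(1) by simp
  qed
  then have "(LINT t:{0..1}|lborel. (\<Sum>\<^sub>\<infinity>j. (norm (h j t))\<^sup>2))
      = (LINT t:{0..1}|lborel. (\<Sum>j\<in>B. (norm (h j t))\<^sup>2))"
    by (intro set_lebesgue_integral_cong) auto
  also have "\<dots> = integral {0..1} (\<lambda>t. \<Sum>j\<in>B. (norm (h j t))\<^sup>2)"
    by (intro set_borel_integral_eq_integral borel_integrable_atLeastAtMost' continuous_intros cont)
  finally show ?thesis by (simp add: L2_l2_norm_def)
qed

text \<open>Integrating the lower bound for H' leaves only boundary values of \<open>H\<close>,
  which vanish.\<close>

lemma integral_energy_bound:
  fixes H H' N M :: "real \<Rightarrow> real"
  assumes H: "\<And>t. t \<in> {0..1} \<Longrightarrow> (H has_vector_derivative H' t) (at t within {0..1})"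
    and "H 0 = 0" "H 1 = 0"
    and le: "\<And>t. t \<in> {0..1} \<Longrightarrow> b * N t - M t / 2 \<le> H' t"
    and cont: "continuous_on {0..1} N" "continuous_on {0..1} M"
  shows "b * integral {0..1} N \<le> integral {0..1} M / 2"
proof -
  have "(H' has_integral H 1 - H 0) {0..1}"
    using H by (intro fundamental_theorem_of_calculus) auto
  moreover have "((\<lambda>t. b * N t - M t / 2) has_integral b * integral {0..1} N - integral {0..1} M / 2) {0..1}"
    using cont
    by (intro has_integral_diff has_integral_mult_right has_integral_divide integrable_integral
        integrable_continuous_real)
  ultimately have "b * integral {0..1} N - integral {0..1} M / 2 \<le> H 1 - H 0"
    using le by (meson has_integral_le)
  then show ?thesis using assms by simp
qed

lemma has_vector_derivative_Re_Im:
  assumes "(f has_vector_derivative f') F"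
  shows "((\<lambda>t. Re (f t)) has_vector_derivative Re f') F"
    and "((\<lambda>t. Im (f t)) has_vector_derivative Im f') F"
  using bounded_linear.has_vector_derivative[OF bounded_linear_Re assms]
    bounded_linear.has_vector_derivative[OF bounded_linear_Im assms] by auto

section \<open>Time derivatives and lattice increments of the exponent\<close>

lemma lattice_point_axis:
  "lattice_point (j + axis k 1) = lattice_point j + axis k 1"
  "lattice_point (j - axis k 1) = lattice_point j - axis k 1"
  by (auto simp: lattice_point_def axis_def vec_eq_iff)

lemma norm_add_axis_sq:
  fixes z :: "real ^ 'd::finite"
  shows "(norm (z + c *\<^sub>R axis k 1))\<^sup>2 = (norm z)\<^sup>2 + 2 * c * z $ k + c\<^sup>2"
  unfolding power2_norm_eq_inner
  by (simp add: inner_add_left inner_add_right inner_axis inner_axis' algebra_simps power2_eq_square)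

definition exponent :: "'d::finite \<Rightarrow> real \<Rightarrow> real \<Rightarrow> real \<Rightarrow> int ^ 'd \<Rightarrow> real \<Rightarrow> real" where
  "exponent k1 \<mu> \<epsilon> R j t = \<mu> * (norm (lattice_point j + (R * t * (1 - t)) *\<^sub>R axis k1 1))\<^sup>2
          - (1 + \<epsilon>) * R\<^sup>2 * t * (1 - t) / (16 * \<mu>)"

lemma carleman_weight_eq_exp: "carleman_weight k1 \<mu> \<epsilon> R j t = exp (exponent k1 \<mu> \<epsilon> R j t)"
  by (simp add: carleman_weight_def exponent_def)

definition exponent_deriv :: "'d::finite \<Rightarrow> real \<Rightarrow> real \<Rightarrow> real \<Rightarrow> int ^ 'd \<Rightarrow> real \<Rightarrow> real" where
  "exponent_deriv k1 \<mu> \<epsilon> R j t = 2 * \<mu> * (of_int (j $ k1) + R * t * (1 - t)) * (R * (1 - 2 * t))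
     - (1 + \<epsilon>) * R\<^sup>2 * (1 - 2 * t) / (16 * \<mu>)"

lemma exponent_expand:
  "exponent k1 \<mu> \<epsilon> R j t = \<mu> * ((norm (lattice_point j))\<^sup>2 + 2 * (R * t * (1 - t)) * of_int (j $ k1) + (R * t * (1 - t))\<^sup>2)
          - (1 + \<epsilon>) * R\<^sup>2 * t * (1 - t) / (16 * \<mu>)"
  unfolding exponent_def norm_add_axis_sq by (simp add: lattice_point_def)

lemma exponent_has_derivative:
  assumes "\<mu> > 0"
  shows "(exponent k1 \<mu> \<epsilon> R j has_real_derivative exponent_deriv k1 \<mu> \<epsilon> R j t) (at t within A)"
  unfolding exponent_expand[abs_def] exponent_deriv_def using assms
  by (auto intro!: derivative_eq_intros simp: field_simps power2_eq_square)

text \<open>The term (1 + epsilon) R^2 / (8 mu) is split in two: the first share pays the edge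
  costs, and the epsilon share is the gain that survives.\<close>

lemma exponent_deriv_has_derivative:
  assumes "\<mu> > 0"
  shows "(exponent_deriv k1 \<mu> \<epsilon> R j has_real_derivative
    2 * \<mu> * (R * (1 - 2 * t))\<^sup>2 - 4 * R * \<mu> * (of_int (j $ k1) + R * t * (1 - t))
      + R\<^sup>2 / (8 * \<mu>) + \<epsilon> * R\<^sup>2 / (8 * \<mu>)) (at t within A)"
  unfolding exponent_deriv_def using assms
  by (auto intro!: derivative_eq_intros simp: field_simps power2_eq_square)

text \<open>The exponent is quadratic in space with leading coefficient mu, so its increment over a
  unit step is affine, with slope 2 mu, in the midpoint of the edge.\<close>

lemma exponent_shift:
  fixes k1 k :: "'d::finite" and R t
  defines "y \<equiv> \<lambda>j. of_int (j $ k) + (if k = k1 then R * t * (1 - t) else 0)"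
  shows "exponent k1 \<mu> \<epsilon> R (j + axis k 1) t = exponent k1 \<mu> \<epsilon> R j t + 2 * \<mu> * (y j + 1/2)"
    and "exponent k1 \<mu> \<epsilon> R (j - axis k 1) t = exponent k1 \<mu> \<epsilon> R j t - 2 * \<mu> * (y j - 1/2)"
proof -
  define z where "z = lattice_point j + (R * t * (1 - t)) *\<^sub>R axis k1 1"
  have zk: "z $ k = y j"
    by (simp add: z_def y_def lattice_point_def axis_def)
  have plus: "lattice_point (j + axis k 1) + (R * t * (1 - t)) *\<^sub>R axis k1 1 = z + 1 *\<^sub>R axis k 1"
    and minus: "lattice_point (j - axis k 1) + (R * t * (1 - t)) *\<^sub>R axis k1 1 = z + (- 1) *\<^sub>R axis k 1"
    by (simp_all add: lattice_point_axis z_def)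
  show "exponent k1 \<mu> \<epsilon> R (j + axis k 1) t = exponent k1 \<mu> \<epsilon> R j t + 2 * \<mu> * (y j + 1/2)"
    and "exponent k1 \<mu> \<epsilon> R (j - axis k 1) t = exponent k1 \<mu> \<epsilon> R j t - 2 * \<mu> * (y j - 1/2)"
    unfolding exponent_def plus minus norm_add_axis_sq zk z_def[symmetric]
    by (simp_all add: algebra_simps)
qed

section \<open>The Carleman inequality\<close>

lemma carleman_inequality:
  fixes k1 :: "'d::finite" and g :: "int ^ 'd \<Rightarrow> real \<Rightarrow> complex"
  assumes "\<epsilon> > 0" "\<mu> > 0" "R \<ge> 0"
    and cost: "\<And>p y. cost \<mu> R p (y + 1/2) + cost \<mu> R p (1/2 - y) \<le>
      4 * sinh (2 * \<mu>) * (sinh (2 * \<mu> * y))\<^sup>2 + 2 * \<mu> * p\<^sup>2 - 4 * R * \<mu> * y + R\<^sup>2 / (8 * \<mu>)"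
    and g: "g \<in> C0_infinity"
  shows "R * sqrt (\<epsilon> / (8 * \<mu>)) *
      L2_l2_norm (\<lambda>j t. carleman_weight k1 \<mu> \<epsilon> R j t *\<^sub>R g j t)
    \<le> L2_l2_norm (\<lambda>j t. carleman_weight k1 \<mu> \<epsilon> R j t *\<^sub>R schroedinger_op g j t)"
proof -
  define J where "J = {j. \<exists>t\<in>{0..1}. g j t \<noteq> 0}"
  define B where "B = (\<lambda>(j, v). j + v) ` (J \<times> steps)"
  have J: "finite J" using g by (simp add: J_def C0_infinity_def)
  have B: "finite B" unfolding B_def using J finite_steps by auto
  have in_B: "j + v \<in> B" if "j \<in> J" "v \<in> steps" for j v
    unfolding B_def using that by force
  \<comment> \<open>The second derivative serves to make \<open>g'\<close> continuous, hence the
    integrand on the right as well.\<close>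
  have "\<exists>g' g''. \<forall>t\<in>{0..1}. (g j has_vector_derivative g' t) (at t within {0..1}) \<and>
      (g' has_vector_derivative g'' t) (at t within {0..1})" for j
  proof -
    have "smooth_on_unit_interval (g j)" using g by (simp add: C0_infinity_def)
    then obtain D where "D 0 = g j"
      and "\<forall>n. \<forall>t\<in>{0..1}. (D n has_vector_derivative D (Suc n) t) (at t within {0..1})"
      unfolding smooth_on_unit_interval_def by blast
    then show ?thesis by metis
  qed
  then obtain g' g'' where g': "\<And>j t. t \<in> {0..1} \<Longrightarrow> (g j has_vector_derivative g' j t) (at t within {0..1})"
    and g'': "\<And>j t. t \<in> {0..1} \<Longrightarrow> (g' j has_vector_derivative g'' j t) (at t within {0..1})"
    by metis
  have cont_g: "continuous_on {0..1} (g j)" and cont_g': "continuous_on {0..1} (g' j)" for j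
    by (rule continuous_on_vector_derivative, rule g' g'', assumption)+
  have g'_eq: "vector_derivative (g j) (at t within {0..1}) = g' j t" if "t \<in> {0..1}" for j t
    using that by (intro vector_derivative_within_closed_interval g') auto

  define \<psi> where "\<psi> = exponent k1 \<mu> \<epsilon> R"
  define w where "w = exponent_deriv k1 \<mu> \<epsilon> R"
  define p where "p t = R * (1 - 2 * t)" for t
  define \<theta> where "\<theta> t k = (if k = k1 then R * t * (1 - t) else 0)" for t k
  define f where "f j t = exp (\<psi> j t) *\<^sub>R g j t" for j t
  define F where "F j t = exp (\<psi> j t) *\<^sub>R (g' j t - \<i> * discrete_laplacian (\<lambda>l. g l t) j)" for j t
  define f' where "f' j t = exp (\<psi> j t) *\<^sub>R (g' j t + w j t *\<^sub>R g j t)" for j t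
  define w' where "w' j t = 2 * \<mu> * (p t)\<^sup>2 - 4 * R * \<mu> * (of_int (j $ k1) + R * t * (1 - t))
      + R\<^sup>2 / (8 * \<mu>) + \<epsilon> * R\<^sup>2 / (8 * \<mu>)" for j t
  define y where "y k j t = of_int (j $ k) + \<theta> t k" for k and j :: "int ^ 'd" and t
  \<comment> \<open>This is <S f, f>: the two orientations of an edge contribute equally, which
    gives the factor 2 and one term per edge.\<close>
  define H where "H t = (\<Sum>j\<in>B. w j t * (norm (f j t))\<^sup>2
      + 2 * (\<Sum>k\<in>UNIV. sinh (2 * \<mu> * (y k j t + 1/2)) * Im (f (j + axis k 1) t * cnj (f j t))))" for t
  define H' where "H' t = (\<Sum>j\<in>B. w' j t * (norm (f j t))\<^sup>2 + 2 * w j t * Re (f' j t * cnj (f j t))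
        + 2 * (\<Sum>k\<in>UNIV. (if k = k1 then 2 * \<mu> * p t * cosh (2 * \<mu> * (y k j t + 1/2)) else 0)
              * Im (f (j + axis k 1) t * cnj (f j t))
          + sinh (2 * \<mu> * (y k j t + 1/2))
              * Im (f' (j + axis k 1) t * cnj (f j t) + f (j + axis k 1) t * cnj (f' j t))))" for t

  have \<psi>_deriv: "(\<psi> j has_real_derivative w j t) (at t within A)" for j t A
    unfolding \<psi>_def w_def using assms by (intro exponent_has_derivative)
  have w_deriv: "(w j has_vector_derivative w' j t) (at t within A)" for j t A
    unfolding w_def w'_def p_def has_real_derivative_iff_has_vector_derivative[symmetric]
    using assms by (intro exponent_deriv_has_derivative)
  have y_deriv: "((\<lambda>t. sinh (2 * \<mu> * (y k j t + 1/2))) has_vector_derivative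
      (if k = k1 then 2 * \<mu> * p t * cosh (2 * \<mu> * (y k j t + 1/2)) else 0)) (at t within A)" for k j t A
    unfolding has_real_derivative_iff_has_vector_derivative[symmetric] y_def \<theta>_def p_def
    by (cases "k = k1") (auto intro!: derivative_eq_intros simp: algebra_simps)
  have f_deriv: "(f j has_vector_derivative f' j t) (at t within {0..1})" if "t \<in> {0..1}" for j t
  proof -
    have "((\<lambda>t. exp (\<psi> j t)) has_real_derivative exp (\<psi> j t) * w j t) (at t within {0..1})"
      by (rule derivative_eq_intros \<psi>_deriv refl)+
    from has_vector_derivative_scaleR[OF this g'[OF that, of j]] show ?thesis
      unfolding f_def[abs_def] f'_def by (simp add: algebra_simps)
  qed
  have cont_\<psi>: "continuous_on {0..1} (\<psi> j)" for j
    using \<psi>_deriv by (meson DERIV_continuous continuous_on_eq_continuous_within)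
  have cont_f: "continuous_on {0..1} (f j)" for j
    unfolding f_def[abs_def] by (intro continuous_intros cont_\<psi> cont_g)
  have cont_F: "continuous_on {0..1} (F j)" for j
    unfolding F_def[abs_def] discrete_laplacian_def by (intro continuous_intros cont_\<psi> cont_g cont_g')

  have f_in_J: "j \<in> J" if "f j t \<noteq> 0" "t \<in> {0..1}" for j t
    using that by (auto simp: f_def J_def)
  have f_zero: "f j t = 0" if "j \<notin> B" "t \<in> {0..1}" for j t
    using f_in_J[of j t] in_B[of j 0] that by auto
  have F_zero: "F j t = 0" if "j \<notin> B" "t \<in> {0..1}" for j t
  proof -
    \<comment> \<open>Since \<open>steps\<close> is symmetric, a point equal or adjacent to some
      \<open>j\<close> outside \<open>B\<close> lies outside the support.\<close>
    have g0: "g i s = 0" if "i - j \<in> steps" "s \<in> {0..1}" for i s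
    proof -
      have "j - i \<in> steps" using that by (auto simp: steps_def algebra_simps eq_diff_eq)
      then have "i \<notin> J" using in_B[of i "j - i"] \<open>j \<notin> B\<close> by auto
      then show ?thesis using that by (auto simp: J_def)
    qed
    have "(g j has_vector_derivative 0) (at t within {0..1})"
      by (rule has_vector_derivative_transform[OF that(2) _ has_vector_derivative_const[of 0]])
        (simp add: g0)
    then have "g' j t = 0"
      using vector_derivative_within_closed_interval[OF zero_less_one that(2)] g'_eq[OF that(2)] by metis
    moreover have "discrete_laplacian (\<lambda>l. g l t) j = 0"
      using that by (simp add: discrete_laplacian_def g0)
    ultimately show ?thesis by (simp add: F_def)
  qed

  have H_deriv: "(H has_vector_derivative H' t) (at t within {0..1})" if t: "t \<in> {0..1}" for t
  proof -
    have n: "(norm z)\<^sup>2 = Re (z * cnj z)" for z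
      unfolding cmod_power2 by (simp add: power2_eq_square)
    note d = f_deriv[OF t]
    have "((\<lambda>t. w j t * (norm (f j t))\<^sup>2) has_vector_derivative
        w' j t * (norm (f j t))\<^sup>2 + 2 * w j t * Re (f' j t * cnj (f j t))) (at t within {0..1})" for j
      using has_vector_derivative_mult[OF w_deriv[of j t "{0..1}"] has_vector_derivative_Re_Im(1)[OF
        has_vector_derivative_mult[OF d[of j] has_vector_derivative_cnj[OF d[of j]]]]]
      unfolding n by (simp add: algebra_simps)
    moreover have "((\<lambda>t. sinh (2 * \<mu> * (y k j t + 1/2)) * Im (f (j + axis k 1) t * cnj (f j t)))
      has_vector_derivative (if k = k1 then 2 * \<mu> * p t * cosh (2 * \<mu> * (y k j t + 1/2)) else 0)
              * Im (f (j + axis k 1) t * cnj (f j t))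
          + sinh (2 * \<mu> * (y k j t + 1/2))
              * Im (f' (j + axis k 1) t * cnj (f j t) + f (j + axis k 1) t * cnj (f' j t)))
      (at t within {0..1})" for j k
      using has_vector_derivative_mult[OF y_deriv[of k j t "{0..1}"] has_vector_derivative_Re_Im(2)[OF
        has_vector_derivative_mult[OF d[of "j + axis k 1"] has_vector_derivative_cnj[OF d[of j]]]]]
      by (simp only: add.commute)
    ultimately show ?thesis
      unfolding H_def[abs_def] H'_def
      by (intro has_vector_derivative_sum has_vector_derivative_add has_vector_derivative_mult_right)
  qed

  have coercive: "\<epsilon> * R\<^sup>2 / (8 * \<mu>) * (\<Sum>j\<in>B. (norm (f j t))\<^sup>2) - (\<Sum>j\<in>B. (norm (F j t))\<^sup>2) / 2 \<le> H' t"
    if t: "t \<in> {0..1}" for t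
  proof -
    interpret weighted_lattice \<mu> "\<theta> t" B "\<lambda>j. f j t"
      using B in_B f_in_J t by unfold_locales auto
    have p: "\<bar>p t\<bar> \<le> R"
    proof -
      have "\<bar>1 - 2 * t\<bar> \<le> 1" using t by (auto simp: abs_le_iff)
      then have "R * \<bar>1 - 2 * t\<bar> \<le> R * 1" using assms by (intro mult_left_mono) auto
      then show ?thesis using assms by (simp add: p_def abs_mult)
    qed
    have pos_y: "pos k j = y k j t" for k j by (simp add: pos_def y_def)
    have u: "f' j t = F j t + w j t *\<^sub>R f j t
        + \<i> * ((\<Sum>k\<in>UNIV. sym_part k j + skew_part k j) - (2 * real CARD('d)) *\<^sub>R f j t)" for j
    proof -
      \<comment> \<open>The combinations \<open>ch - sh\<close> and \<open>ch + sh\<close> are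
        exponentials of increments of the exponent, and they convert the weight at each neighbour
        into the weight at \<open>j\<close>.\<close>
      have exchange: "sym_part k j + skew_part k j = exp (\<psi> j t) *\<^sub>R (g (j + axis k 1) t + g (j - axis k 1) t)" for k
      proof -
        have "ch k j - sh k j = exp (- (2 * \<mu> * (y k j t + 1/2)))"
          by (simp add: ch_def sh_def pos_y cosh_minus_sinh)
        moreover have "ch k (j - axis k 1) + sh k (j - axis k 1) = exp (2 * \<mu> * (y k j t - 1/2))"
        proof -
          have e: "pos k (j - axis k 1) + 1/2 = y k j t - 1/2" by (simp add: pos_y[symmetric])
          show ?thesis unfolding ch_def sh_def e by (rule cosh_plus_sinh)
        qed
        moreover have "\<psi> (j + axis k 1) t = \<psi> j t + 2 * \<mu> * (y k j t + 1/2)"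
          "\<psi> (j - axis k 1) t = \<psi> j t - 2 * \<mu> * (y k j t - 1/2)"
          unfolding \<psi>_def y_def \<theta>_def by (rule exponent_shift)+
        ultimately have "(ch k j - sh k j) * exp (\<psi> (j + axis k 1) t) = exp (\<psi> j t)"
          "(ch k (j - axis k 1) + sh k (j - axis k 1)) * exp (\<psi> (j - axis k 1) t) = exp (\<psi> j t)"
          by (simp_all flip: exp_add)
        moreover have "sym_part k j + skew_part k j = (ch k j - sh k j) *\<^sub>R f (j + axis k 1) t
            + (ch k (j - axis k 1) + sh k (j - axis k 1)) *\<^sub>R f (j - axis k 1) t"
          by (simp add: sym_part_def skew_part_def algebra_simps)
        ultimately show ?thesis by (simp add: f_def scaleR_add_right)
      qed
      \<comment> \<open>Every direction contributes -2 on the diagonal of the Laplacian, which fixes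
        the constant \<open>c\<close> as twice the dimension.\<close>
      have "(\<Sum>k\<in>UNIV. g (j + axis k 1) t + g (j - axis k 1) t)
          = discrete_laplacian (\<lambda>l. g l t) j + (2 * real CARD('d)) *\<^sub>R g j t"
        unfolding discrete_laplacian_def by (simp add: sum.distrib sum_subtractf scaleR_conv_of_real)
      then show ?thesis
        unfolding exchange scaleR_sum_right[symmetric]
        by (simp add: f'_def F_def f_def algebra_simps scaleR_conv_of_real)
    qed
    have w: "w (j + axis k 1) t - w j t = (if k = k1 then 2 * \<mu> * p t else 0)" for j k
      by (auto simp: w_def exponent_deriv_def p_def axis_def algebra_simps)
    have w': "w' j t = 2 * \<mu> * (p t)\<^sup>2 - 4 * R * \<mu> * pos k1 j + R\<^sup>2 / (8 * \<mu>) + \<epsilon> * R\<^sup>2 / (8 * \<mu>)" for j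
      by (simp add: w'_def pos_def \<theta>_def)
    show ?thesis
      using energy_derivative_coercive[OF assms(2) p cost u w w']
      unfolding H'_def ch_def sh_def pos_y .
  qed

  have "\<epsilon> * R\<^sup>2 / (8 * \<mu>) * integral {0..1} (\<lambda>t. \<Sum>j\<in>B. (norm (f j t))\<^sup>2)
      \<le> integral {0..1} (\<lambda>t. \<Sum>j\<in>B. (norm (F j t))\<^sup>2) / 2"
  proof (rule integral_energy_bound[OF H_deriv _ _ coercive])
    have "f j 0 = 0" "f j 1 = 0" for j
      using g by (auto simp: f_def C0_infinity_def)
    then show "H 0 = 0" "H 1 = 0" by (simp_all add: H_def)
  qed (assumption | intro continuous_intros cont_f cont_F)+
  \<comment> \<open>The energy argument gives a bound better by a factor 1/2, which is given away
    here.\<close>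
  also have "\<dots> \<le> integral {0..1} (\<lambda>t. \<Sum>j\<in>B. (norm (F j t))\<^sup>2)"
    by (simp add: integral_nonneg sum_nonneg integrable_continuous_real continuous_intros cont_F)
  finally have "sqrt (\<epsilon> * R\<^sup>2 / (8 * \<mu>)) * sqrt (integral {0..1} (\<lambda>t. \<Sum>j\<in>B. (norm (f j t))\<^sup>2))
      \<le> sqrt (integral {0..1} (\<lambda>t. \<Sum>j\<in>B. (norm (F j t))\<^sup>2))"
    unfolding real_sqrt_mult[symmetric] by (rule real_sqrt_le_mono)
  moreover have "sqrt (\<epsilon> * R\<^sup>2 / (8 * \<mu>)) = R * sqrt (\<epsilon> / (8 * \<mu>))"
    using assms by (simp add: real_sqrt_mult real_sqrt_divide)
  moreover have "L2_l2_norm (\<lambda>j t. carleman_weight k1 \<mu> \<epsilon> R j t *\<^sub>R g j t)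
      = sqrt (integral {0..1} (\<lambda>t. \<Sum>j\<in>B. (norm (f j t))\<^sup>2))"
    unfolding carleman_weight_eq_exp \<psi>_def[symmetric] f_def[symmetric]
    by (intro L2_l2_norm_finite B f_zero cont_f)
  moreover have "L2_l2_norm (\<lambda>j t. carleman_weight k1 \<mu> \<epsilon> R j t *\<^sub>R schroedinger_op g j t)
      = sqrt (integral {0..1} (\<lambda>t. \<Sum>j\<in>B. (norm (F j t))\<^sup>2))"
  proof -
    have "carleman_weight k1 \<mu> \<epsilon> R j t *\<^sub>R schroedinger_op g j t = F j t" if "t \<in> {0..1}" for j t
      using that by (simp add: carleman_weight_eq_exp \<psi>_def F_def schroedinger_op_def g'_eq)
    then have "L2_l2_norm (\<lambda>j t. carleman_weight k1 \<mu> \<epsilon> R j t *\<^sub>R schroedinger_op g j t) = L2_l2_norm F"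
      unfolding L2_l2_norm_def by (intro arg_cong[where f = sqrt] set_lebesgue_integral_cong) auto
    then show ?thesis using L2_l2_norm_finite[OF B F_zero cont_F] by simp
  qed
  ultimately show ?thesis by simp
qed

theorem lemma4p1:
  fixes k1 :: "'d::finite" and \<mu> \<epsilon> :: real
  assumes "\<epsilon> > 0" and "\<mu> > 0"
  shows "\<exists>R0. \<forall>R\<ge>R0. \<forall>g \<in> (C0_infinity :: (int ^ 'd \<Rightarrow> real \<Rightarrow> complex) set).
    R * sqrt (\<epsilon> / (8 * \<mu>)) *
      L2_l2_norm (\<lambda>j t. carleman_weight k1 \<mu> \<epsilon> R j t *\<^sub>R g j t)
    \<le> L2_l2_norm (\<lambda>j t. carleman_weight k1 \<mu> \<epsilon> R j t *\<^sub>R schroedinger_op g j t)"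
proof -
  \<comment> \<open>The threshold comes from the scalar inequality alone, so it depends on
    \<open>\<mu>\<close> but not on \<open>\<epsilon>\<close> or \<open>g\<close>.\<close>
  obtain R0 where "R0 \<ge> 0" and R0: "\<And>R p y. R \<ge> R0 \<Longrightarrow>
      cost \<mu> R p (y + 1/2) + cost \<mu> R p (1/2 - y) \<le>
      4 * sinh (2 * \<mu>) * (sinh (2 * \<mu> * y))\<^sup>2 + 2 * \<mu> * p\<^sup>2 - 4 * R * \<mu> * y + R\<^sup>2 / (8 * \<mu>)"
    using total_cost[OF assms(2)] by auto
  show ?thesis
  proof (intro exI allI impI ballI)
    fix R and g :: "int ^ 'd \<Rightarrow> real \<Rightarrow> complex"
    assume R: "R \<ge> R0" and g: "g \<in> C0_infinity"
    show "R * sqrt (\<epsilon> / (8 * \<mu>)) *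
      L2_l2_norm (\<lambda>j t. carleman_weight k1 \<mu> \<epsilon> R j t *\<^sub>R g j t)
    \<le> L2_l2_norm (\<lambda>j t. carleman_weight k1 \<mu> \<epsilon> R j t *\<^sub>R schroedinger_op g j t)"
      using assms R \<open>R0 \<ge> 0\<close> g by (intro carleman_inequality R0) auto
  qed
qed

end
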